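(* Let $\mathbf{S}\subset\mathbb{R}^n$ and $\mathbf{B}\subset\mathbb{R}^m$ be compact basic semi-algebraic sets and $f:\mathbb{R}^n\to\mathbb{R}^m$ a polynomial map with $\mathbf{F}:=f(\mathbf{S})\subset\mathbf{B}$. Consider the infinite-dimensional linear program $$p^*:=\sup_{\mu_0,\mu_1,\hat\mu_1}\ \int\mu_1\quad\text{s.t.}\quad\mu_1+\hat\mu_1=\lambda_{\mathbf{B}},\quad\mu_1=f_\#\mu_0,\quad\mu_0\in\mathcal{M}_+(\mathbf{S}),\ \mu_1,\hat\mu_1\in\mathcal{M}_+(\mathbf{B}),$$ where $\int\mu_1=\mu_1(\mathbf{B})$ is the total mass of $\mu_1$. This linear program admits an optimal solution $(\mu_0^*,\mu_1^*,\hat\mu_1^* )$. Moreover, $\mu_1^*=\lambda_{\mathbf{F}}$, and the optimal value is $p^*=\operatorname{vol}\mathbf{F}$.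
   Context: A basic semi-algebraic set is one of the form $\{g_1\ge0,\dots,g_k\ge0\}$ for finitely many real polynomials $g_i$. For a compact set $\mathbf{A}$, $\mathcal{M}(\mathbf{A})$ is the space of finite signed Borel measures supported on $\mathbf{A}$ and $\mathcal{M}_+(\mathbf{A})$ its cone of nonnegative elements. For $\mu_0\in\mathcal{M}(\mathbf{S})$, the image measure $f_\#\mu_0\in\mathcal{M}(\mathbf{B})$ is defined by $f_\#\mu_0(\mathbf{A}):=\mu_0(\{\mathbf{x}\in\mathbf{S}:f(\mathbf{x})\in\mathbf{A}\})$ for Borel $\mathbf{A}\subset\mathbf{B}$. For $\mathbf{A}\subset\mathbf{B}$, $\lambda_{\mathbf{A}}(d\mathbf{y}):=\mathbf{1}_{\mathbf{A}}(\mathbf{y})\,d\mathbf{y}$ is the restriction of Lebesgue measure on $\mathbb{R}^m$ to $\mathbf{A}$, and $\operatorname{vol}$ is Lebesgue measure on $\mathbb{R}^m$. *)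

theory Defs
  imports "HOL-Analysis.Analysis"
begin

definition basic_semialgebraic :: "(real ^ 'n) set \<Rightarrow> bool" where
  "basic_semialgebraic S \<longleftrightarrow>
     (\<exists>G. finite G \<and> (\<forall>g\<in>G. real_polynomial_function g) \<and> S = {x. \<forall>g\<in>G. g x \<ge> 0})"

(* The cone M_+(A) for compact A.  Its elements are measures on the Borel sigma-algebra of the
   whole space; since A is closed, "supported on A" means that the complement of A is null. *)
definition pos_measures_on :: "(real ^ 'n) set \<Rightarrow> (real ^ 'n) measure set" where
  "pos_measures_on A = {\<mu>. sets \<mu> = sets borel \<and> finite_measure \<mu> \<and> emeasure \<mu> (- A) = 0}"

definition image_measure ::
  "(real ^ 'n) set \<Rightarrow> (real ^ 'n \<Rightarrow> real ^ 'm) \<Rightarrow> (real ^ 'n) measure \<Rightarrow> (real ^ 'm) measure" where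
  "image_measure S f \<mu> = distr (restrict_space \<mu> S) borel f"

lemma emeasure_image_measure:
  assumes "sets \<mu> = sets borel" "S \<in> sets borel" "f \<in> borel_measurable borel" "A \<in> sets borel"
  shows "emeasure (image_measure S f \<mu>) A = emeasure \<mu> {x\<in>S. f x \<in> A}"
proof -
  have sp: "space \<mu> = UNIV"
    using sets_eq_imp_space_eq[OF assms(1)] by simp
  have "f \<in> borel_measurable \<mu>"
    using assms(1,3) by (simp cong: measurable_cong_sets)
  then have "f \<in> measurable (restrict_space \<mu> S) borel"
    by (rule measurable_restrict_space1)
  then have "emeasure (image_measure S f \<mu>) A
      = emeasure (restrict_space \<mu> S) (f -` A \<inter> space (restrict_space \<mu> S))"
    unfolding image_measure_def using assms(4) by (rule emeasure_distr)
  also have "f -` A \<inter> space (restrict_space \<mu> S) = {x\<in>S. f x \<in> A}"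
    by (auto simp: space_restrict_space sp)
  also have "emeasure (restrict_space \<mu> S) {x\<in>S. f x \<in> A} = emeasure \<mu> {x\<in>S. f x \<in> A}"
    by (rule emeasure_restrict_space) (use assms sp in auto)
  finally show ?thesis .
qed

definition lebesgue_on_set :: "(real ^ 'm) set \<Rightarrow> (real ^ 'm) measure" where
  "lebesgue_on_set A = density lborel (indicator A)"

(* The sum of measures is not a library operation, so the constraint mu1 + nu = lambda_B is
   stated on every Borel set. *)
definition lp_feasible ::
  "(real ^ 'n) set \<Rightarrow> (real ^ 'm) set \<Rightarrow> (real ^ 'n \<Rightarrow> real ^ 'm) \<Rightarrow>
   ((real ^ 'n) measure \<times> (real ^ 'm) measure \<times> (real ^ 'm) measure) set" where
  "lp_feasible S B f = {(\<mu>0, \<mu>1, \<nu>).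
     \<mu>0 \<in> pos_measures_on S \<and> \<mu>1 \<in> pos_measures_on B \<and> \<nu> \<in> pos_measures_on B \<and>
     (\<forall>A\<in>sets borel. emeasure \<mu>1 A + emeasure \<nu> A = emeasure (lebesgue_on_set B) A) \<and>
     \<mu>1 = image_measure S f \<mu>0}"

definition lp_objective ::
  "(real ^ 'm) set \<Rightarrow> (real ^ 'n) measure \<times> (real ^ 'm) measure \<times> (real ^ 'm) measure \<Rightarrow> real" where
  "lp_objective B = (\<lambda>(\<mu>0, \<mu>1, \<nu>). measure \<mu>1 B)"

definition lp_value ::
  "(real ^ 'n) set \<Rightarrow> (real ^ 'm) set \<Rightarrow> (real ^ 'n \<Rightarrow> real ^ 'm) \<Rightarrow> ereal" where
  "lp_value S B f = (SUP t\<in>lp_feasible S B f. ereal (lp_objective B t))"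

definition lp_optimal ::
  "(real ^ 'n) set \<Rightarrow> (real ^ 'm) set \<Rightarrow> (real ^ 'n \<Rightarrow> real ^ 'm) \<Rightarrow>
   (real ^ 'n) measure \<times> (real ^ 'm) measure \<times> (real ^ 'm) measure \<Rightarrow> bool" where
  "lp_optimal S B f t \<longleftrightarrow>
     t \<in> lp_feasible S B f \<and> (\<forall>t'\<in>lp_feasible S B f. lp_objective B t' \<le> lp_objective B t)"

end

theory Submission
  imports Defs
begin

text \<open>
  Every feasible \<open>\<mu>1\<close> is dominated by Lebesgue measure on \<open>B\<close> and vanishes off \<open>F = f(S)\<close>, so it is
  dominated by Lebesgue measure \<open>\<lambda>\<close> on \<open>F\<close>, and equal total mass forces equality. For attainment, a
  Borel section \<open>g\<close> of \<open>f\<close> over \<open>F\<close> gives the feasible point with \<open>\<mu>0\<close> the image of \<open>\<lambda>\<close> under \<open>g\<close>.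
  The section is found by shrinking the fibre over \<open>y\<close>: run through a sequence of closed sets that
  separates points and intersect with each one whenever the result is nonempty. What
  remains is a single point of the fibre.
\<close>

section \<open>Borel sections of continuous maps on compact sets\<close>

primrec shrunk_fibre ::
  "('a \<Rightarrow> 'b) \<Rightarrow> 'a set \<Rightarrow> (nat \<Rightarrow> 'a set) \<Rightarrow> 'b \<Rightarrow> nat \<Rightarrow> 'a set" where
  "shrunk_fibre f S C y 0 = {x\<in>S. f x = y}"
| "shrunk_fibre f S C y (Suc k) =
     (let K = shrunk_fibre f S C y k in if K \<inter> C k = {} then K else K \<inter> C k)"

lemma shrunk_fibre_Suc_subset: "shrunk_fibre f S C y (Suc k) \<subseteq> shrunk_fibre f S C y k"
  by (auto simp: Let_def)

lemma antimono_shrunk_fibre: "antimono (shrunk_fibre f S C y)"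
  using shrunk_fibre_Suc_subset by (rule decseq_SucI)

lemma shrunk_fibre_nonempty: "y \<in> f ` S \<Longrightarrow> shrunk_fibre f S C y k \<noteq> {}"
  by (induction k) (auto simp: Let_def)

lemma compact_shrunk_fibre:
  fixes f :: "'a::t2_space \<Rightarrow> 'b::t1_space"
  assumes "compact S" "continuous_on S f" "\<And>k. closed (C k)"
  shows "compact (shrunk_fibre f S C y k)"
proof (induction k)
  case 0
  have "closed (S \<inter> f -` {y})"
    using assms compact_imp_closed by (intro continuous_closed_preimage) auto
  then have "compact (S \<inter> (S \<inter> f -` {y}))"
    using assms(1) by (rule compact_Int_closed[rotated])
  moreover have "S \<inter> (S \<inter> f -` {y}) = {x\<in>S. f x = y}" by auto
  ultimately show ?case by simp
qed (use assms(3) in \<open>auto simp: Let_def intro: compact_Int_closed\<close>)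

text \<open>Stage 0 meets \<open>D\<close> exactly when \<open>y\<close> lies in the image of
  \<open>S \<inter> D\<close>, which is compact. Later hit sets are Boolean combinations of earlier
  ones. \<open>D\<close> varies in the induction because the step also needs \<open>C k\<close> and
  \<open>C k \<inter> D\<close>.\<close>

lemma shrunk_fibre_hits_measurable:
  fixes f :: "'a::t2_space \<Rightarrow> 'b::t2_space"
  assumes "compact S" "continuous_on S f" "\<And>k. closed (C k)" "closed D"
  shows "{y. shrunk_fibre f S C y k \<inter> D \<noteq> {}} \<in> sets borel"
  using assms(4)
proof (induction k arbitrary: D)
  case 0
  have "compact (f ` (S \<inter> D))"
    using assms 0
    by (intro compact_continuous_image compact_Int_closed) (auto intro: continuous_on_subset)
  moreover have "{y. shrunk_fibre f S C y 0 \<inter> D \<noteq> {}} = f ` (S \<inter> D)" by auto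
  ultimately show ?case by (simp add: borel_compact)
next
  case (Suc k)
  let ?H = "\<lambda>D. {y. shrunk_fibre f S C y k \<inter> D \<noteq> {}}"
  \<comment> \<open>If stage \<open>k\<close> meets \<open>C k\<close>, the next stage meets
    \<open>D\<close> iff stage \<open>k\<close> meets \<open>C k \<inter> D\<close>; otherwise the
    stage is unchanged.\<close>
  have "{y. shrunk_fibre f S C y (Suc k) \<inter> D \<noteq> {}} =
      (?H (C k) \<inter> ?H (C k \<inter> D)) \<union> (?H D - ?H (C k))"
    by (auto simp: Let_def Int_assoc split: if_splits)
  also have "\<dots> \<in> sets borel"
    using Suc.IH[OF assms(3)[of k]] Suc.IH[OF Suc.prems]
      Suc.IH[OF closed_Int[OF assms(3)[of k] Suc.prems]]
    by (intro sets.Un sets.Int sets.Diff)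
  finally show ?case .
qed

text \<open>Complements of a countable basis work: by the T1 axiom \<open>- {x}\<close> is open, so
  some basic set contains \<open>y\<close> and misses \<open>x\<close>.\<close>

lemma separating_closed_sequence:
  obtains C :: "nat \<Rightarrow> 'a::{second_countable_topology,t1_space} set"
  where "\<And>k. closed (C k)" "\<And>x y. x \<noteq> y \<Longrightarrow> \<exists>k. x \<in> C k \<and> y \<notin> C k"
proof -
  obtain \<B> :: "'a set set" where \<B>: "countable \<B>" "topological_basis \<B>"
    using ex_countable_basis by blast
  \<comment> \<open>Adding the empty set makes the family nonempty, as its enumeration requires; the
    complement of the empty set is closed too.\<close>
  define C where "C = (\<lambda>k. - from_nat_into (insert {} \<B>) k)"
  have rng: "range (from_nat_into (insert {} \<B>)) = insert {} \<B>"
    by (rule range_from_nat_into) (use \<B> in auto)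
  show ?thesis
  proof
    fix k
    have "from_nat_into (insert {} \<B>) k \<in> insert {} \<B>"
      by (rule from_nat_into) simp
    then show "closed (C k)"
      using topological_basis_open[OF \<B>(2)] by (auto simp: C_def)
  next
    fix x y :: 'a assume "x \<noteq> y"
    then obtain U where "U \<in> \<B>" "y \<in> U" "U \<subseteq> - {x}"
      using topological_basisE[OF \<B>(2), of "- {x}" y] by auto
    then obtain k where "from_nat_into (insert {} \<B>) k = U"
      using rng by (metis imageE insertCI)
    then show "\<exists>k. x \<in> C k \<and> y \<notin> C k"
      using \<open>y \<in> U\<close> \<open>U \<subseteq> - {x}\<close> by (auto simp: C_def)
  qed
qed

text \<open>For \<open>y\<close> in the image and \<open>D\<close> closed,
  \<open>g y \<in> D\<close> amounts to countably many Borel conditions: every stage meets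
  \<open>D\<close>.\<close>

lemma borel_section_compact:
  fixes f :: "'a::{second_countable_topology,heine_borel} \<Rightarrow> 'b::t2_space"
  assumes S: "compact S" and f: "continuous_on S f"
  obtains g where "g \<in> borel_measurable borel" "\<And>y. y \<in> f ` S \<Longrightarrow> g y \<in> S \<and> f (g y) = y"
proof -
  obtain C :: "nat \<Rightarrow> 'a set" where C: "\<And>k. closed (C k)"
    and sep: "\<And>x y. x \<noteq> y \<Longrightarrow> \<exists>k. x \<in> C k \<and> y \<notin> C k"
    by (rule separating_closed_sequence) blast
  define K where "K = shrunk_fibre f S C"
  have K_compact: "compact (K y k)" for y k
    unfolding K_def using S f C by (rule compact_shrunk_fibre)
  have K_anti: "K y n \<subseteq> K y m" if "m \<le> n" for y m n
    using antimonoD[OF antimono_shrunk_fibre that] unfolding K_def .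
  \<comment> \<open>Decreasing nonempty compact sets have a common point. Taking
    \<open>D = UNIV\<close> yields the section, arbitrary closed \<open>D\<close> its
    measurability.\<close>
  have meets: "(\<Inter>k. K y k \<inter> D) \<noteq> {}" if "closed D" "\<And>k. K y k \<inter> D \<noteq> {}" for y D
    using that K_compact K_anti by (intro compact_nest compact_Int_closed Int_mono) auto
  \<comment> \<open>Off the image \<open>g\<close> is constant, so there a preimage is everything or
    nothing.\<close>
  define g where "g y = (if y \<in> f ` S then SOME x. x \<in> (\<Inter>k. K y k) else undefined)" for y
  have g_in: "g y \<in> K y k" if "y \<in> f ` S" for y k
  proof -
    have "(\<Inter>k. K y k \<inter> UNIV) \<noteq> {}"
      using shrunk_fibre_nonempty[OF that] by (intro meets) (auto simp: K_def)
    then have "\<exists>x. x \<in> (\<Inter>k. K y k)" by blast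
    then have "g y \<in> (\<Inter>k. K y k)"
      unfolding g_def if_P[OF that] by (rule someI_ex)
    then show ?thesis by auto
  qed
  have g_unique: "x = g y" if "y \<in> f ` S" "\<And>k. x \<in> K y k" for x y
  proof (rule ccontr)
    assume "x \<noteq> g y"
    \<comment> \<open>Stage \<open>k\<close> meets \<open>C k\<close> at \<open>x\<close>, so the
      next stage lies inside \<open>C k\<close> and expels \<open>g y\<close>.\<close>
    then obtain k where "x \<in> C k" "g y \<notin> C k" using sep by blast
    then have "K y k \<inter> C k \<noteq> {}" using that(2)[of k] by auto
    then have "K y (Suc k) \<subseteq> C k" by (auto simp: K_def Let_def)
    then show False using g_in[OF that(1)] \<open>g y \<notin> C k\<close> by blast
  qed
  have F: "f ` S \<in> sets borel"
    by (intro borel_compact compact_continuous_image f S)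
  have preimage: "g -` D \<in> sets borel" if "closed D" for D
  proof -
    \<comment> \<open>If all stages meet \<open>D\<close>, compactness gives a point of
      \<open>D\<close> common to all of them, and by uniqueness it is \<open>g y\<close>. Conversely
      \<open>g y\<close> itself lies in every stage.\<close>
    have iff: "g y \<in> D \<longleftrightarrow> (\<forall>k. K y k \<inter> D \<noteq> {})" if "y \<in> f ` S" for y
      using meets[OF \<open>closed D\<close>, of y] g_in[OF that] g_unique[OF that] by fast
    have out: "g y = undefined" if "y \<notin> f ` S" for y
      using that by (simp add: g_def)
    have "g -` D =
        (f ` S \<inter> (\<Inter>k. {y. K y k \<inter> D \<noteq> {}})) \<union> (if undefined \<in> D then - (f ` S) else {})"
      (is "_ = ?R")
    proof (rule set_eqI)
      show "y \<in> g -` D \<longleftrightarrow> y \<in> ?R" for y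
        using iff[of y] out[of y] by (cases "y \<in> f ` S") simp_all
    qed
    also have "\<dots> \<in> sets borel"
    proof (intro sets.Un sets.Int F sets.countable_INT')
      show "(\<lambda>k. {y. K y k \<inter> D \<noteq> {}}) ` UNIV \<subseteq> sets borel"
        using shrunk_fibre_hits_measurable[OF S f C that] by (auto simp: K_def)
    qed (use F in auto)
    finally show ?thesis .
  qed
  have "g \<in> measurable borel (sigma UNIV (Collect closed))"
    using preimage by (intro measurable_measure_of) auto
  then have "g \<in> borel_measurable borel"
    by (simp add: borel_eq_closed)
  moreover have "g y \<in> S \<and> f (g y) = y" if "y \<in> f ` S" for y
    using g_in[OF that, of 0] by (auto simp: K_def)
  ultimately show ?thesis using that by blast
qed

section \<open>Lebesgue measure restricted to Borel sets\<close>

lemma sets_lebesgue_on_set [simp]: "sets (lebesgue_on_set A) = sets borel"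
  by (simp add: lebesgue_on_set_def)

lemma emeasure_lebesgue_on_set:
  assumes "F \<in> sets borel" "A \<in> sets borel"
  shows "emeasure (lebesgue_on_set F) A = emeasure lborel (F \<inter> A)"
  using assms by (simp add: lebesgue_on_set_def emeasure_density indicator_inter_arith[symmetric])

lemma emeasure_lborel_finite:
  assumes "compact K"
  shows "emeasure lborel (K :: (real ^ 'm) set) < \<infinity>"
  using emeasure_bounded_finite[OF compact_imp_bounded[OF assms]] .

text \<open>Finiteness comes from compactness of \<open>B\<close>. Asking \<open>F\<close> only to
  be Borel covers both the image of \<open>S\<close> and its complement in \<open>B\<close>.\<close>

lemma lebesgue_on_set_pos_measures:
  fixes B :: "(real ^ 'm) set"
  assumes "compact B" "F \<in> sets borel" "F \<subseteq> B"
  shows "lebesgue_on_set F \<in> pos_measures_on B"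
proof -
  have B: "B \<in> sets borel" using assms(1) by (rule borel_compact)
  have "emeasure lborel F < \<infinity>"
    using emeasure_mono[OF assms(3), of lborel] B emeasure_lborel_finite[OF assms(1)] by auto
  moreover have "space (lebesgue_on_set F) = UNIV"
    by (simp add: lebesgue_on_set_def)
  ultimately have "finite_measure (lebesgue_on_set F)"
    using assms(2) by (intro finite_measureI) (simp add: emeasure_lebesgue_on_set)
  moreover have "F \<inter> - B = {}" using assms(3) by auto
  ultimately show ?thesis
    using B assms(2) by (simp add: pos_measures_on_def emeasure_lebesgue_on_set)
qed

section \<open>Upper bound and attainment for the linear program\<close>

lemma feasible_dominated:
  fixes f :: "real ^ 'n \<Rightarrow> real ^ 'm"
  assumes "compact S" "compact B" "continuous_on UNIV f" "f ` S \<subseteq> B"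
    and "(\<mu>0, \<mu>1, \<nu>) \<in> lp_feasible S B f" "A \<in> sets borel"
  shows "emeasure \<mu>1 A \<le> emeasure (lebesgue_on_set (f ` S)) A"
proof -
  let ?F = "f ` S"
  have F: "?F \<in> sets borel" and B: "B \<in> sets borel" and S: "S \<in> sets borel"
    using assms
    by (auto intro!: borel_compact compact_continuous_image intro: continuous_on_subset)
  have f: "f \<in> borel_measurable borel"
    using assms(3) by (rule borel_measurable_continuous_onI)
  have \<mu>0: "sets \<mu>0 = sets borel" and \<mu>1: "\<mu>1 = image_measure S f \<mu>0"
    and sum: "\<And>A. A \<in> sets borel \<Longrightarrow>
      emeasure \<mu>1 A + emeasure \<nu> A = emeasure (lebesgue_on_set B) A"
    using assms(5) by (auto simp: lp_feasible_def pos_measures_on_def)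
  \<comment> \<open>The image measure charges only \<open>?F\<close>, so \<open>A\<close> may be cut
    down to \<open>?F \<inter> A\<close> before the constraint on \<open>B\<close> is
    applied.\<close>
  have "{x\<in>S. f x \<in> A} = {x\<in>S. f x \<in> ?F \<inter> A}" by auto
  then have "emeasure \<mu>1 A = emeasure \<mu>1 (?F \<inter> A)"
    using assms(6) F by (simp add: \<mu>1 emeasure_image_measure[OF \<mu>0 S f])
  also have "\<dots> \<le> emeasure \<mu>1 (?F \<inter> A) + emeasure \<nu> (?F \<inter> A)" by simp
  also have "\<dots> = emeasure lborel (B \<inter> (?F \<inter> A))"
    using assms(6) F B by (simp add: sum emeasure_lebesgue_on_set)
  also have "B \<inter> (?F \<inter> A) = ?F \<inter> A" using assms(4) by auto
  finally show ?thesis using assms(6) F by (simp add: emeasure_lebesgue_on_set)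
qed

lemma feasible_attained:
  fixes f :: "real ^ 'n \<Rightarrow> real ^ 'm"
  assumes "compact S" "compact B" "continuous_on UNIV f" "f ` S \<subseteq> B"
  shows "\<exists>\<mu>0. (\<mu>0, lebesgue_on_set (f ` S), lebesgue_on_set (B - f ` S)) \<in> lp_feasible S B f"
proof -
  let ?F = "f ` S"
  let ?L = "lebesgue_on_set ?F"
  have contS: "continuous_on S f" using assms(3) by (rule continuous_on_subset) simp
  have F: "?F \<in> sets borel" and B: "B \<in> sets borel" and S: "S \<in> sets borel"
    using assms contS by (auto intro!: borel_compact compact_continuous_image)
  have f: "f \<in> borel_measurable borel"
    using assms(3) by (rule borel_measurable_continuous_onI)
  obtain g where g: "g \<in> borel_measurable borel"
    and sec: "\<And>y. y \<in> ?F \<Longrightarrow> g y \<in> S \<and> f (g y) = y"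
    using borel_section_compact[OF assms(1) contS] by blast
  \<comment> \<open>Pushing \<open>?L\<close> back along \<open>g\<close> and then forward along
    \<open>f\<close> recovers \<open>?L\<close>, since \<open>f (g y) = y\<close> on
    \<open>?F\<close>.\<close>
  define \<mu>0 where "\<mu>0 = distr ?L borel g"
  have L: "?L \<in> pos_measures_on B" and "lebesgue_on_set (B - ?F) \<in> pos_measures_on B"
    using assms F B by (auto intro: lebesgue_on_set_pos_measures)
  have \<mu>0_sets: "sets \<mu>0 = sets borel" by (simp add: \<mu>0_def)
  have gL: "g \<in> borel_measurable ?L" using g by (simp cong: measurable_cong_sets)
  have sp: "space ?L = UNIV" by (simp add: lebesgue_on_set_def)
  have \<mu>0_eq: "emeasure \<mu>0 A = emeasure lborel (?F \<inter> g -` A)" if "A \<in> sets borel" for A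
  proof -
    have "g -` A \<in> sets borel" using measurable_sets[OF g that] by simp
    then show ?thesis
      unfolding \<mu>0_def using gL that F by (simp add: emeasure_distr sp emeasure_lebesgue_on_set)
  qed
  have "finite_measure \<mu>0"
    unfolding \<mu>0_def using L gL
    by (intro finite_measure.finite_measure_distr) (auto simp: pos_measures_on_def)
  \<comment> \<open>Only points of \<open>?F\<close> carry mass and \<open>g\<close> sends them into
    \<open>S\<close>, so the default value of \<open>g\<close> is not charged.\<close>
  moreover have "?F \<inter> g -` (- S) = {}" using sec by auto
  then have "emeasure \<mu>0 (- S) = 0" using S by (simp add: \<mu>0_eq)
  ultimately have "\<mu>0 \<in> pos_measures_on S" by (simp add: pos_measures_on_def \<mu>0_def)
  moreover have "emeasure ?L A + emeasure (lebesgue_on_set (B - ?F)) A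
      = emeasure (lebesgue_on_set B) A" if "A \<in> sets borel" for A
  proof -
    have "(?F \<inter> A) \<union> ((B - ?F) \<inter> A) = B \<inter> A" using assms(4) by auto
    moreover have "(?F \<inter> A) \<inter> ((B - ?F) \<inter> A) = {}" by auto
    ultimately show ?thesis
      using that F B plus_emeasure[of "?F \<inter> A" lborel "(B - ?F) \<inter> A"]
      by (simp add: emeasure_lebesgue_on_set)
  qed
  moreover have "?L = image_measure S f \<mu>0"
  proof (rule measure_eqI)
    fix A assume "A \<in> sets ?L"
    then have A: "A \<in> sets borel" by simp
    have "{x\<in>S. f x \<in> A} = S \<inter> f -` A" by auto
    then have "{x\<in>S. f x \<in> A} \<in> sets borel"
      using S measurable_sets[OF f A] by auto
    moreover have "?F \<inter> g -` {x\<in>S. f x \<in> A} = ?F \<inter> A" using sec by auto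
    ultimately show "emeasure ?L A = emeasure (image_measure S f \<mu>0) A"
      using A F S f
      by (subst emeasure_image_measure) (auto simp: \<mu>0_eq \<mu>0_sets emeasure_lebesgue_on_set)
  qed (simp add: image_measure_def)
  ultimately have "(\<mu>0, ?L, lebesgue_on_set (B - ?F)) \<in> lp_feasible S B f"
    using L \<open>lebesgue_on_set (B - ?F) \<in> pos_measures_on B\<close> by (simp add: lp_feasible_def)
  then show ?thesis ..
qed

section \<open>Uniqueness of the optimal image measure, and the optimal value\<close>

lemma finite_measure_eqI_dominated:
  assumes "finite_measure N" "sets M = sets N"
    and le: "\<And>A. A \<in> sets N \<Longrightarrow> emeasure M A \<le> emeasure N A"
    and total: "emeasure M (space M) = emeasure N (space N)"
  shows "M = N"
proof (rule measure_eqI)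
  interpret N: finite_measure N by fact
  have sp: "space M = space N" using assms(2) by (rule sets_eq_imp_space_eq)
  fix A assume "A \<in> sets M"
  then have A: "A \<in> sets N" "A \<in> sets M" and A': "space N - A \<in> sets N" "space N - A \<in> sets M"
    using assms(2) by auto
  have part: "emeasure P A + emeasure P (space N - A) = emeasure P (space N)"
    if "sets P = sets N" for P
    using plus_emeasure[of A P "space N - A"] A A' that sets.sets_into_space[OF A(1)]
    by (simp add: Un_absorb1)
  \<comment> \<open>A deficit of \<open>M\<close> on \<open>A\<close> would need a surplus on the
    complement, which domination forbids. The cancellation that follows uses finiteness of
    \<open>N\<close>.\<close>
  have "emeasure N A + emeasure N (space N - A) = emeasure M A + emeasure M (space N - A)"
    using part[of M] part[of N] assms(2) total sp by simp
  also have "\<dots> \<le> emeasure M A + emeasure N (space N - A)"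
    using le[OF A'(1)] by (rule add_left_mono)
  finally have "emeasure N A \<le> emeasure M A"
    by (metis N.emeasure_finite add.commute ennreal_add_left_cancel_le infinity_ennreal_def)
  then show "emeasure M A = emeasure N A" using le[OF A(1)] by simp
qed (fact assms(2))

theorem lemma4p2:
  fixes S :: "(real ^ 'n) set" and B :: "(real ^ 'm) set" and f :: "real ^ 'n \<Rightarrow> real ^ 'm"
  assumes "compact S" and "basic_semialgebraic S"
    and "compact B" and "basic_semialgebraic B"
    and "polynomial_function f"
    and "f ` S \<subseteq> B"
  shows "(\<exists>\<mu>0 \<mu>1 \<nu>. lp_optimal S B f (\<mu>0, \<mu>1, \<nu>)) \<and>
    (\<forall>\<mu>0 \<mu>1 \<nu>. lp_optimal S B f (\<mu>0, \<mu>1, \<nu>) \<longrightarrow> \<mu>1 = lebesgue_on_set (f ` S)) \<and>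
    lp_value S B f = ereal (measure lborel (f ` S))"
proof -
  let ?F = "f ` S"
  let ?L = "lebesgue_on_set ?F"
  have f: "continuous_on UNIV f"
    using assms(5) by (rule continuous_on_polymonial_function)
  then have Fc: "compact ?F"
    using assms(1) by (intro compact_continuous_image) (auto intro: continuous_on_subset)
  then have F: "?F \<in> sets borel" by (rule borel_compact)
  have B: "B \<in> sets borel" using assms(3) by (rule borel_compact)
  note dominated = feasible_dominated[OF assms(1,3) f assms(6)]
  have L: "?L \<in> pos_measures_on B"
    using assms(3) F assms(6) by (rule lebesgue_on_set_pos_measures)
  then interpret L: finite_measure ?L by (simp add: pos_measures_on_def)
  have LB: "measure ?L B = measure lborel ?F"
    using assms(6) F B by (simp add: measure_def emeasure_lebesgue_on_set Int_absorb2)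
  obtain \<mu>0 where opt: "(\<mu>0, ?L, lebesgue_on_set (B - ?F)) \<in> lp_feasible S B f"
    using feasible_attained[OF assms(1,3) f assms(6)] by blast
  have le: "lp_objective B t \<le> measure lborel ?F" if "t \<in> lp_feasible S B f" for t
  proof -
    obtain \<mu>0 \<mu>1 \<nu> where t: "t = (\<mu>0, \<mu>1, \<nu>)" by (cases t)
    have "measure \<mu>1 B \<le> measure ?L B"
      using dominated[OF that[unfolded t] B] L.emeasure_finite[of B]
      unfolding measure_def by (intro enn2real_mono) (auto simp del: L.emeasure_finite simp: less_top)
    then show ?thesis by (simp add: t lp_objective_def LB)
  qed
  have optimal: "lp_optimal S B f (\<mu>0, ?L, lebesgue_on_set (B - ?F))"
    using opt le by (simp add: lp_optimal_def lp_objective_def LB)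
  \<comment> \<open>An optimal triple has at least the objective value of the feasible point above,
    which is the inequality opposite to domination on \<open>B\<close>.\<close>
  have unique: "\<mu>1 = ?L" if t: "lp_optimal S B f (\<mu>0', \<mu>1, \<nu>)" for \<mu>0' \<mu>1 \<nu>
  proof -
    have feas: "(\<mu>0', \<mu>1, \<nu>) \<in> lp_feasible S B f"
      and ge: "measure \<mu>1 B \<ge> measure ?L B"
      using t opt by (auto simp: lp_optimal_def lp_objective_def)
    have pos: "\<mu>1 \<in> pos_measures_on B"
      using feas unfolding lp_feasible_def by blast
    then interpret M: finite_measure \<mu>1 by (simp add: pos_measures_on_def)
    \<comment> \<open>Equality of masses is known on \<open>B\<close>, while the comparison of
      measures asks for it on the whole space; the complement of \<open>B\<close> is null.\<close>
    have total: "emeasure P (space P) = emeasure P B" if "P \<in> pos_measures_on B" for P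
    proof -
      have "sets P = sets borel" "emeasure P (- B) = 0"
        using that by (auto simp: pos_measures_on_def)
      moreover from this have "space P = UNIV" using sets_eq_imp_space_eq by fastforce
      ultimately show ?thesis
        using plus_emeasure[of B P "- B"] B by auto
    qed
    have "emeasure \<mu>1 B = emeasure ?L B"
      using ge dominated[OF feas B]
      by (simp add: M.emeasure_eq_measure L.emeasure_eq_measure)
    then show ?thesis
      using pos dominated[OF feas] total[OF pos] total[OF L]
      by (intro finite_measure_eqI_dominated) (auto simp: pos_measures_on_def L.finite_measure_axioms)
  qed
  \<comment> \<open>The bound holds at every feasible triple and the constructed one attains
    it.\<close>
  have "lp_value S B f = ereal (measure lborel ?F)"
    unfolding lp_value_def
  proof (rule antisym)
    show "(SUP t\<in>lp_feasible S B f. ereal (lp_objective B t)) \<le> ereal (measure lborel ?F)"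
      using le by (auto intro: SUP_least)
    show "ereal (measure lborel ?F) \<le> (SUP t\<in>lp_feasible S B f. ereal (lp_objective B t))"
      by (rule SUP_upper2[OF opt]) (simp add: lp_objective_def LB)
  qed
  with optimal unique show ?thesis by blast
qed

end
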